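(* There exists a $6\times 3$ limited augmented bipartite graph $G=(S,T,E_1\cup E_2)$ with total edge count $|E_1|+|E_2|=12$ that satisfies (S), (W1), (W2), (W2') and (W3) (i.e. is weak admissible). Consequently, $$z_{wL}(6,3)\ge 12>11=z_L(6,3),$$ and hence $\mathrm{BSR}(6,3)\ge 12$.
   Context: Notation: $[m]=\{1,\dots,m\}$. An $m\times n$ biquadratic form is a real polynomial $P(\mathbf{x},\mathbf{y})=\sum_{i,k=1}^m\sum_{j,l=1}^n a_{ijkl}x_ix_ky_jy_l$ (with $a_{ijkl}=a_{kjil}=a_{klij}$). It is SOS if $P=\sum_{p=1}^r f_p^2$ with each $f_p$ a real bilinear form in $(\mathbf{x},\mathbf{y})$; the minimum such $r$ is its SOS rank $\mathrm{SOS}(P)$. $\mathrm{BSR}(m,n)$ is the maximum SOS rank among all $m\times n$ SOS biquadratic forms. $z(m,n)$ (the Zarankiewicz number) is the maximum number of edges of an $m\times n$ bipartite graph with no $C_4$. Augmented bipartite graphs $G=(S,T,E_1\cup E_2)$, $S=[m]$, $T=[n]$. A cell is a pair $(i,j)\in[m]\times[n]$ ($i$ is its row, $j$ its column). A 1-edge is a cell; $E_1$ is a set of 1-edges, viewed as a bipartite graph $G_1$ on $S,T$. A 2-edge is an unordered pair of distinct cells, written $(i,j;k,l)$; the cells $(i,j)$ and $(k,l)$ are its two halves. It is nondegenerate if $i\ne k$ and $j\ne l$, row-degenerate if $i=k$ and $j\neq l$, column-degenerate if $i\ne k$ and $j=l$. $E_2$ is a set of 2-edges. $G$ is called limited if $|E_1|=z(m,n)$.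 A cell is occupied if it is in $E_1$ or is a half of some 2-edge in $E_2$; otherwise it is unoccupied. The opposite cells of a nondegenerate 2-edge $(i,j;k,l)$ are $(i,l)$ and $(k,j)$. Two nondegenerate 2-edges of the form $(i,j;k,l)$ and $(i,l;k,j)$ are called complementary. The dependency graph $\mathcal{D}$ is the directed graph whose vertices are the nondegenerate 2-edges in $E_2$, with an arc $e\to e'$ ($e\ne e'$) if both opposite cells of $e$ are occupied and one half of $e'$ is an opposite cell of $e$. An edge's row (column) set is the set of rows (columns) of its cell (1-edge) or of its halves (2-edge). Two edges are vertex-disjoint if their row sets are disjoint and their column sets are disjoint. The opposite cells of a vertex-disjoint pair $e,f$ are the cells formed by a row of one of the two edges and a column of the other. For a 1-edge $(i,j)$ and a 2-edge $(k,l;p,q)$ they are $(i,l),(i,q),(k,j),(p,j)$. Conditions: (S) No 2-edge shares a cell with any 1-edge or with any other 2-edge. (W1) $G_1$ contains no $C_4$. (W2) $\mathcal{D}$ contains no directed cycle other than 2-cycles formed by a pair of complementary 2-edges (which are allowed). (W2') There is no nondegenerate 2-edge in $E_2$ whose two opposite cells are both 1-edges. (W3) For every vertex-disjoint pair of edges of $G$ at least one of which is a 2-edge, at least one of the opposite cells of the pair is unoccupied. $z_{wL}(m,n)$ is the maximum of $|E_1|+|E_2|$ over all limited $G$ satisfying (S), (W1), (W2), (W2'), (W3). $z_L(m,n)$ (the limited augmented Zarankiewicz number) is the maximum of $|E_1|+|E_2|$ over all limited $G$ satisfying (S), (W1), and the two original conditions: (Condition 2) no nondegenerate 2-edge in $E_2$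 has both of its opposite cells occupied; (Condition 3) there are no 2-edge $(i,j;p,q)\in E_2$ and cell $(k,l)$ with $k\notin\{i,p\}$, $l\notin\{j,q\}$ such that all of the cells $(k,l),(k,j),(k,q),(i,l),(p,l)$ are occupied. *)

theory Defs
  imports Complex_Main "Graph_Theory.Graph_Theory"
begin

section \<open>Biquadratic forms and SOS rank\<close>

text \<open>
  Real polynomials in \<open>x\<^sub>1,\<dots>,x\<^sub>m,y\<^sub>1,\<dots>,y\<^sub>n\<close> are represented by the polynomial functions
  they induce (over the infinite field of reals the two notions coincide); a vector is a
  function on \<open>nat\<close> of which only the entries with index in \<open>{1..m}\<close>, resp. \<open>{1..n}\<close>,
  are used.
\<close>

type_synonym form = "(nat \<Rightarrow> real) \<Rightarrow> (nat \<Rightarrow> real) \<Rightarrow> real"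

definition biquadratic_form :: "nat \<Rightarrow> nat \<Rightarrow> form \<Rightarrow> bool" where
  "biquadratic_form m n P \<longleftrightarrow>
     (\<exists>a :: nat \<Rightarrow> nat \<Rightarrow> nat \<Rightarrow> nat \<Rightarrow> real.
        (\<forall>i\<in>{1..m}. \<forall>k\<in>{1..m}. \<forall>j\<in>{1..n}. \<forall>l\<in>{1..n}.
           a i j k l = a k j i l \<and> a i j k l = a k l i j) \<and>
        P = (\<lambda>x y. \<Sum>i=1..m. \<Sum>k=1..m. \<Sum>j=1..n. \<Sum>l=1..n.
                     a i j k l * x i * x k * y j * y l))"

definition bilinear_form :: "nat \<Rightarrow> nat \<Rightarrow> form \<Rightarrow> bool" where
  "bilinear_form m n f \<longleftrightarrow>
     (\<exists>b :: nat \<Rightarrow> nat \<Rightarrow> real. f = (\<lambda>x y. \<Sum>i=1..m. \<Sum>j=1..n. b i j * x i * y j))"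

definition sum_of_squares :: "nat \<Rightarrow> nat \<Rightarrow> nat \<Rightarrow> form \<Rightarrow> bool" where
  "sum_of_squares m n r P \<longleftrightarrow>
     (\<exists>f :: nat \<Rightarrow> form. (\<forall>p\<in>{1..r}. bilinear_form m n (f p)) \<and>
        P = (\<lambda>x y. \<Sum>p=1..r. (f p x y)\<^sup>2))"

definition SOS :: "nat \<Rightarrow> nat \<Rightarrow> form \<Rightarrow> bool" where
  "SOS m n P \<longleftrightarrow> (\<exists>r. sum_of_squares m n r P)"

definition SOS_rank :: "nat \<Rightarrow> nat \<Rightarrow> form \<Rightarrow> nat" where
  "SOS_rank m n P = (LEAST r. sum_of_squares m n r P)"

definition BSR :: "nat \<Rightarrow> nat \<Rightarrow> nat" where
  "BSR m n = Max {SOS_rank m n P | P. biquadratic_form m n P \<and> SOS m n P}"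

section \<open>Augmented bipartite graphs\<close>

type_synonym cell = "nat \<times> nat"

text \<open>
  A bipartite graph on \<open>{1..m}\<close> and \<open>{1..n}\<close> is given by its set of edges, each a cell
  \<open>(row, column)\<close>. A 2-edge is the two-element set of its halves.
\<close>

definition cells :: "nat \<Rightarrow> nat \<Rightarrow> cell set" where
  "cells m n = {1..m} \<times> {1..n}"

definition contains_C4 :: "cell set \<Rightarrow> bool" where
  "contains_C4 E \<longleftrightarrow>
     (\<exists>i j k l. i \<noteq> k \<and> j \<noteq> l \<and> {(i,j), (i,l), (k,j), (k,l)} \<subseteq> E)"

definition zarankiewicz :: "nat \<Rightarrow> nat \<Rightarrow> nat" where
  "zarankiewicz m n = Max {card E | E. E \<subseteq> cells m n \<and> \<not> contains_C4 E}"

definition aug_bipartite :: "nat \<Rightarrow> nat \<Rightarrow> cell set \<Rightarrow> cell set set \<Rightarrow> bool" where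
  "aug_bipartite m n E1 E2 \<longleftrightarrow>
     E1 \<subseteq> cells m n \<and> (\<forall>e\<in>E2. e \<subseteq> cells m n \<and> card e = 2)"

definition limited :: "nat \<Rightarrow> nat \<Rightarrow> cell set \<Rightarrow> bool" where
  "limited m n E1 \<longleftrightarrow> card E1 = zarankiewicz m n"

definition occupied :: "cell set \<Rightarrow> cell set set \<Rightarrow> cell set" where
  "occupied E1 E2 = E1 \<union> \<Union>E2"

definition nondegenerate :: "cell set \<Rightarrow> bool" where
  "nondegenerate e \<longleftrightarrow> (\<exists>i j k l. e = {(i,j), (k,l)} \<and> i \<noteq> k \<and> j \<noteq> l)"

text \<open>
  Since \<open>{(i,j), (k,l)} = {(k,l), (i,j)}\<close>, the following set contains both \<open>(i,l)\<close> and \<open>(k,j)\<close>.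
\<close>

definition opposite_cells :: "cell set \<Rightarrow> cell set" where
  "opposite_cells e = {(i,l) | i j k l. e = {(i,j), (k,l)} \<and> i \<noteq> k \<and> j \<noteq> l}"

definition complementary :: "cell set \<Rightarrow> cell set \<Rightarrow> bool" where
  "complementary e f \<longleftrightarrow>
     (\<exists>i j k l. i \<noteq> k \<and> j \<noteq> l \<and> e = {(i,j), (k,l)} \<and> f = {(i,l), (k,j)})"

definition dependency_graph :: "cell set \<Rightarrow> cell set set \<Rightarrow> cell set pair_pre_digraph" where
  "dependency_graph E1 E2 =
     \<lparr> pverts = {e \<in> E2. nondegenerate e},
       parcs = {(e, e'). e \<in> E2 \<and> nondegenerate e \<and> e' \<in> E2 \<and> nondegenerate e' \<and> e \<noteq> e' \<and>
                 opposite_cells e \<subseteq> occupied E1 E2 \<and> e' \<inter> opposite_cells e \<noteq> {}} \<rparr>"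

text \<open>In the following two definitions a 1-edge \<open>c\<close> is passed as the singleton \<open>{c}\<close>.\<close>

definition vertex_disjoint :: "cell set \<Rightarrow> cell set \<Rightarrow> bool" where
  "vertex_disjoint e f \<longleftrightarrow> fst ` e \<inter> fst ` f = {} \<and> snd ` e \<inter> snd ` f = {}"

definition pair_opposite_cells :: "cell set \<Rightarrow> cell set \<Rightarrow> cell set" where
  "pair_opposite_cells e f = fst ` e \<times> snd ` f \<union> fst ` f \<times> snd ` e"

definition cond_S :: "cell set \<Rightarrow> cell set set \<Rightarrow> bool" where
  "cond_S E1 E2 \<longleftrightarrow>
     (\<forall>e\<in>E2. e \<inter> E1 = {} \<and> (\<forall>f\<in>E2. e \<noteq> f \<longrightarrow> e \<inter> f = {}))"

definition cond_W1 :: "cell set \<Rightarrow> bool" where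
  "cond_W1 E1 \<longleftrightarrow> \<not> contains_C4 E1"

text \<open>
  A library cycle is a nonempty closed list of arcs without repeated vertices, so
  \<open>[(e, f), (f, e)]\<close> is the 2-cycle through \<open>e\<close> and \<open>f\<close>. Loops do not occur in the
  dependency graph.
\<close>

definition cond_W2 :: "cell set \<Rightarrow> cell set set \<Rightarrow> bool" where
  "cond_W2 E1 E2 \<longleftrightarrow>
     (\<forall>p. pre_digraph.cycle (with_proj (dependency_graph E1 E2)) p \<longrightarrow>
        (\<exists>e f. complementary e f \<and> p = [(e, f), (f, e)]))"

definition cond_W2' :: "cell set \<Rightarrow> cell set set \<Rightarrow> bool" where
  "cond_W2' E1 E2 \<longleftrightarrow> \<not> (\<exists>e\<in>E2. nondegenerate e \<and> opposite_cells e \<subseteq> E1)"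

definition cond_W3 :: "cell set \<Rightarrow> cell set set \<Rightarrow> bool" where
  "cond_W3 E1 E2 \<longleftrightarrow>
     (\<forall>e\<in>E2. \<forall>f \<in> E2 \<union> {{c} | c. c \<in> E1}. vertex_disjoint e f \<longrightarrow>
        (\<exists>c \<in> pair_opposite_cells e f. c \<notin> occupied E1 E2))"

definition weak_admissible :: "cell set \<Rightarrow> cell set set \<Rightarrow> bool" where
  "weak_admissible E1 E2 \<longleftrightarrow>
     cond_S E1 E2 \<and> cond_W1 E1 \<and> cond_W2 E1 E2 \<and> cond_W2' E1 E2 \<and> cond_W3 E1 E2"

definition cond_2 :: "cell set \<Rightarrow> cell set set \<Rightarrow> bool" where
  "cond_2 E1 E2 \<longleftrightarrow>
     \<not> (\<exists>e\<in>E2. nondegenerate e \<and> opposite_cells e \<subseteq> occupied E1 E2)"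

definition cond_3 :: "cell set \<Rightarrow> cell set set \<Rightarrow> bool" where
  "cond_3 E1 E2 \<longleftrightarrow>
     \<not> (\<exists>i j p q k l. {(i,j), (p,q)} \<in> E2 \<and> k \<notin> {i, p} \<and> l \<notin> {j, q} \<and>
          {(k,l), (k,j), (k,q), (i,l), (p,l)} \<subseteq> occupied E1 E2)"

definition z_wL :: "nat \<Rightarrow> nat \<Rightarrow> nat" where
  "z_wL m n = Max {card E1 + card E2 | E1 E2.
     aug_bipartite m n E1 E2 \<and> limited m n E1 \<and> weak_admissible E1 E2}"

definition z_L :: "nat \<Rightarrow> nat \<Rightarrow> nat" where
  "z_L m n = Max {card E1 + card E2 | E1 E2.
     aug_bipartite m n E1 E2 \<and> limited m n E1 \<and>
     cond_S E1 E2 \<and> cond_W1 E1 \<and> cond_2 E1 E2 \<and> cond_3 E1 E2}"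

end

(*
  In each row of the weak admissible witness exactly one cell is unoccupied, or the three cells
  are a 1-edge and a row-degenerate 2-edge; it has no nondegenerate 2-edges, so (W2) and (W2')
  are vacuous.

  SOS rank. Given an SOS decomposition with r squares of the associated form, attach to each cell
  the vector in R^r of its coefficients. Comparing coefficients determines the inner products within
  a row. For two rows, the matrix M of inner products is a skew-symmetric 3 x 3 matrix. Each row of
  cells satisfies a linear relation (an unoccupied cell has the zero vector, the halves of a 2-edge
  have equal vectors), and the relations of the two rows lie in the kernel of M and are independent;
  a skew matrix has even rank, so M = 0. Hence the twelve edges give orthonormal vectors and r >= 12.

  Upper bound on z_L. A C4-free graph with 9 edges has, for each column j, one row D j containing
  exactly the two other columns, and three rows with a single edge. Three 2-edges would leave at
  most 3 cells unoccupied. If some cell (D j, j) is occupied, the conditions force its 2-edge to end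
  in a single-edge row, and make three cells unoccupied whose complement still contains a full
  single-edge row, contradicting Condition 3. Otherwise the three cells (D j, j) are the unoccupied
  ones, all single-edge rows are full, and Condition 3 fails for every 2-edge.
*)
theory Submission
  imports Defs
begin

section \<open>Finiteness of the SOS rank\<close>

lemma sum_of_squares_iff:
  "sum_of_squares m n r P \<longleftrightarrow>
     (\<exists>b. P = (\<lambda>x y. \<Sum>p=1..r. (\<Sum>i=1..m. \<Sum>j=1..n. b p i j * x i * y j)\<^sup>2))"
proof
  assume "sum_of_squares m n r P"
  then obtain f where f: "\<And>p. p \<in> {1..r} \<Longrightarrow> bilinear_form m n (f p)"
    and P: "P = (\<lambda>x y. \<Sum>p=1..r. (f p x y)\<^sup>2)"
    unfolding sum_of_squares_def by blast
  have "\<exists>b. \<forall>p\<in>{1..r}. f p = (\<lambda>x y. \<Sum>i=1..m. \<Sum>j=1..n. b p i j * x i * y j)"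
    using f unfolding bilinear_form_def by (intro bchoice) blast
  then obtain b where
    "\<And>p. p \<in> {1..r} \<Longrightarrow> f p = (\<lambda>x y. \<Sum>i=1..m. \<Sum>j=1..n. b p i j * x i * y j)"
    by blast
  then have "P = (\<lambda>x y. \<Sum>p=1..r. (\<Sum>i=1..m. \<Sum>j=1..n. b p i j * x i * y j)\<^sup>2)"
    unfolding P by (intro ext sum.cong refl) simp
  then show "\<exists>b. P = (\<lambda>x y. \<Sum>p=1..r. (\<Sum>i=1..m. \<Sum>j=1..n. b p i j * x i * y j)\<^sup>2)"
    by (rule exI[of _ b])
qed (auto simp: sum_of_squares_def bilinear_form_def)

text \<open>Indexing by cells turns each square into the square of a linear form in the products x_i
  y_j, so that quadratic-form arguments apply.\<close>

lemma sum_of_squares_cells_iff: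
  "sum_of_squares m n r P \<longleftrightarrow>
     (\<exists>b. P = (\<lambda>x y. \<Sum>p=1..r. (\<Sum>c\<in>cells m n. b p c * (x (fst c) * y (snd c)))\<^sup>2))"
    (is "_ \<longleftrightarrow> (\<exists>b. P = ?Q b)")
proof -
  have eq: "(\<Sum>i=1..m. \<Sum>j=1..n. b i j * x i * y j) =
        (\<Sum>c\<in>cells m n. b (fst c) (snd c) * (x (fst c) * y (snd c)))"
    for b :: "nat \<Rightarrow> nat \<Rightarrow> real" and x y
    unfolding cells_def sum.cartesian_product by (simp add: case_prod_beta mult.assoc)
  show ?thesis
    unfolding sum_of_squares_iff eq
  proof
    assume "\<exists>b. P = ?Q (\<lambda>p c. b p (fst c) (snd c))"
    then show "\<exists>b. P = ?Q b"
      by (elim exE) (rule exI)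
  next
    assume "\<exists>b. P = ?Q b"
    then obtain b where "P = ?Q b" by (elim exE)
    then show "\<exists>b. P = ?Q (\<lambda>p c. b p (fst c) (snd c))"
      by (intro exI[of _ "\<lambda>p i j. b p (i, j)"]) simp
  qed
qed

text \<open>The Gram matrix \<open>g\<close> is symmetric under exchanging its two cells. Averaging
  it with its row-swapped version yields both required symmetries and leaves the polynomial
  unchanged.\<close>

lemma biquadratic_form_if_sum_of_squares:
  assumes "sum_of_squares m n r P"
  shows "biquadratic_form m n P"
proof -
  obtain b where P: "P = (\<lambda>x y. \<Sum>p=1..r. (\<Sum>i=1..m. \<Sum>j=1..n. b p i j * x i * y j)\<^sup>2)"
    using assms unfolding sum_of_squares_iff by blast
  define g where "g i j k l = (\<Sum>p=1..r. b p i j * b p k l)" for i j k l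
  define a where "a i j k l = (g i j k l + g k j i l) / 2" for i j k l
  have g_sym: "g i j k l = g k l i j" for i j k l
    unfolding g_def by (simp add: mult.commute)
  have expand: "P x y = (\<Sum>i=1..m. \<Sum>k=1..m. \<Sum>j=1..n. \<Sum>l=1..n. g i j k l * x i * x k * y j * y l)"
    (is "_ = ?Q") for x y
  proof -
    have "P x y = (\<Sum>p=1..r. \<Sum>i=1..m. \<Sum>k=1..m. \<Sum>j=1..n. \<Sum>l=1..n.
        b p i j * b p k l * x i * x k * y j * y l)"
      unfolding P power2_eq_square sum_product by (simp add: mult_ac)
    also have "\<dots> = (\<Sum>i=1..m. \<Sum>k=1..m. \<Sum>j=1..n. \<Sum>l=1..n. \<Sum>p=1..r.
        b p i j * b p k l * x i * x k * y j * y l)"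
      by (subst sum.swap, rule sum.cong[OF refl])+ (rule refl)
    also have "\<dots> = ?Q"
      unfolding g_def by (simp add: sum_distrib_right)
    finally show ?thesis .
  qed
  have "P = (\<lambda>x y. \<Sum>i=1..m. \<Sum>k=1..m. \<Sum>j=1..n. \<Sum>l=1..n. a i j k l * x i * x k * y j * y l)"
  proof (intro ext)
    fix x y
    have swap: "(\<Sum>i=1..m. \<Sum>k=1..m. \<Sum>j=1..n. \<Sum>l=1..n. g k j i l * x i * x k * y j * y l) = P x y"
      unfolding expand by (subst sum.swap) (simp add: mult_ac)
    have "(\<Sum>i=1..m. \<Sum>k=1..m. \<Sum>j=1..n. \<Sum>l=1..n. a i j k l * x i * x k * y j * y l) =
       (P x y + (\<Sum>i=1..m. \<Sum>k=1..m. \<Sum>j=1..n. \<Sum>l=1..n. g k j i l * x i * x k * y j * y l)) / 2"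
      unfolding expand a_def
      by (simp add: sum.distrib add_divide_distrib sum_divide_distrib distrib_right)
    then show "P x y = (\<Sum>i=1..m. \<Sum>k=1..m. \<Sum>j=1..n. \<Sum>l=1..n. a i j k l * x i * x k * y j * y l)"
      unfolding swap by simp
  qed
  moreover have "a i j k l = a k j i l" "a i j k l = a k l i j" for i j k l
    unfolding a_def by (simp_all add: g_sym[of i l k j] g_sym[of i j k l])
  ultimately show ?thesis
    unfolding biquadratic_form_def by (intro exI[of _ a] conjI ballI)
qed

text \<open>Cholesky factorisation: a pivot \<open>u\<close> is split off and the induction
  hypothesis is applied to the Schur complement.\<close>

lemma psd_decomposition:
  fixes a :: "'a \<Rightarrow> 'a \<Rightarrow> real"
  assumes "finite S"
    and "\<And>s t. a s t = a t s"
    and "\<And>z. 0 \<le> (\<Sum>s\<in>S. \<Sum>t\<in>S. a s t * z s * z t)"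
  shows "\<exists>b. \<forall>s\<in>S. \<forall>t\<in>S. a s t = (\<Sum>w\<in>S. b w s * b w t)"
  using assms
proof (induction S arbitrary: a)
  case empty
  then show ?case by simp
next
  case (insert u S)
  define L where "L z = (\<Sum>s\<in>S. a u s * z s)" for z
  have split: "(\<Sum>s\<in>insert u S. \<Sum>t\<in>insert u S. a s t * z s * z t) =
      a u u * (z u)\<^sup>2 + 2 * z u * L z + (\<Sum>s\<in>S. \<Sum>t\<in>S. a s t * z s * z t)" for z
  proof -
    have "(\<Sum>t\<in>S. a u t * z u * z t) = z u * L z" "(\<Sum>s\<in>S. a s u * z s * z u) = z u * L z"
      unfolding L_def sum_distrib_left by (simp_all add: insert.prems(1)[of _ u] mult_ac)
    then show ?thesis
      using insert.hyps by (simp add: sum.distrib power2_eq_square)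
  qed
  have L_cong: "L (z(u := v)) = L z"
    "(\<Sum>s\<in>S. \<Sum>t\<in>S. a s t * (z(u := v)) s * (z(u := v)) t) = (\<Sum>s\<in>S. \<Sum>t\<in>S. a s t * z s * z t)"
    for z v
    using insert.hyps unfolding L_def by (auto intro!: sum.cong)
  have pos: "0 \<le> a u u * v\<^sup>2 + 2 * v * L z + (\<Sum>s\<in>S. \<Sum>t\<in>S. a s t * z s * z t)" for v z
    using insert.prems(2)[of "z(u := v)"] unfolding split L_cong by simp
  have diag: "0 \<le> a u u"
    using pos[of 1 "\<lambda>_. 0"] by (simp add: L_def)
  have zero: "a u s = 0" if "a u u = 0" "s \<in> S" for s
  proof (rule ccontr)
    assume "a u s \<noteq> 0"
    have e: "L (\<lambda>t. of_bool (t = s)) = a u s"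
      "(\<Sum>r\<in>S. \<Sum>t\<in>S. a r t * of_bool (r = s) * of_bool (t = s)) = a s s"
      using that insert.hyps unfolding L_def
      by (simp_all add: of_bool_def if_distrib[of "times _"] mult.assoc sum_distrib_left[symmetric] cong: if_cong)
    \<comment> \<open>With a zero pivot the expression in \<open>pos\<close> is affine in
      \<open>v\<close>; this value makes it -1.\<close>
    define v where "v = - (a s s + 1) / (2 * a u s)"
    have "2 * v * a u s = - (a s s + 1)"
      using \<open>a u s \<noteq> 0\<close> unfolding v_def by simp
    then show False
      using pos[of v "\<lambda>t. of_bool (t = s)"] that unfolding e by simp
  qed
  \<comment> \<open>Schur complement of the pivot; if the pivot vanishes then so does its row, and \<open>x / 0 = 0\<close>
    makes the formulas below correct in that case too.\<close>
  define a' where "a' s t = a s t - a u s * a u t / a u u" for s t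
  have "0 \<le> (\<Sum>s\<in>S. \<Sum>t\<in>S. a' s t * z s * z t)" for z
  proof -
    have sq: "(\<Sum>s\<in>S. \<Sum>t\<in>S. (a u s * a u t / a u u) * z s * z t) = (L z)\<^sup>2 / a u u"
      unfolding L_def power2_eq_square sum_product sum_divide_distrib
      by (intro sum.cong refl) simp
    have "(\<Sum>s\<in>S. \<Sum>t\<in>S. a' s t * z s * z t) =
        (\<Sum>s\<in>S. \<Sum>t\<in>S. a s t * z s * z t) - (L z)\<^sup>2 / a u u"
      unfolding sq[symmetric] a'_def by (simp add: sum_subtractf left_diff_distrib)
    \<comment> \<open>For a nonzero pivot, \<open>pos\<close> is used at the minimiser of its
      quadratic in \<open>v\<close>.\<close>
    also have "\<dots> \<ge> 0"
      using pos[of "- L z / a u u" z] by (cases "a u u = 0") (auto simp: field_simps power2_eq_square)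
    finally show ?thesis .
  qed
  moreover have "a' s t = a' t s" for s t
    unfolding a'_def by (simp add: insert.prems(1)[of s t] mult.commute)
  ultimately obtain b where b: "\<And>s t. s \<in> S \<Longrightarrow> t \<in> S \<Longrightarrow> a' s t = (\<Sum>w\<in>S. b w s * b w t)"
    using insert.IH[of a'] by blast
  \<comment> \<open>Coordinate \<open>u\<close> carries the pivot row over the root of the pivot;
    the others factor the Schur complement and vanish at \<open>u\<close>.\<close>
  define b' where "b' w s = (if w = u then a u s / sqrt (a u u) else if s = u then 0 else b w s)" for w s
  have u_part: "b' u s * b' u t = a u s * a u t / a u u" for s t
    unfolding b'_def using diag by simp
  have rest: "(\<Sum>w\<in>S. b' w s * b' w t) = (if s = u \<or> t = u then 0 else \<Sum>w\<in>S. b w s * b w t)" for s t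
    using insert.hyps unfolding b'_def by (auto intro!: sum.cong sum.neutral)
  have "a s t = (\<Sum>w\<in>insert u S. b' w s * b' w t)" if st: "s \<in> insert u S" "t \<in> insert u S" for s t
  proof -
    have "(\<Sum>w\<in>insert u S. b' w s * b' w t) =
        a u s * a u t / a u u + (if s = u \<or> t = u then 0 else \<Sum>w\<in>S. b w s * b w t)"
      using insert.hyps by (simp add: u_part rest)
    also have "\<dots> = a s t"
    proof (cases "s = u \<or> t = u")
      case True
      have "a s u = a u s"
        by (rule insert.prems(1))
      moreover have "a u s = 0 \<and> a u t = 0" if "a u u = 0"
        using zero[OF that] st that by blast
      ultimately show ?thesis
        using True by (cases "a u u = 0") auto
    next
      case False
      then show ?thesis
        using st b[of s t] unfolding a'_def by auto
    qed
    finally show ?thesis by simp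
  qed
  then show ?case by blast
qed

lemma SOS_rank_le:
  assumes "SOS m n P"
  shows "SOS_rank m n P \<le> m * n"
proof -
  let ?S = "cells m n"
  have fin: "finite ?S" and card: "card ?S = m * n"
    unfolding cells_def by simp_all
  obtain r :: nat and b where P: "P = (\<lambda>x y. \<Sum>p=1..r. (\<Sum>c\<in>?S. b p c * (x (fst c) * y (snd c)))\<^sup>2)"
    using assms unfolding SOS_def sum_of_squares_cells_iff by blast
  define a where "a s t = (\<Sum>p=1..r. b p s * b p t)" for s t
  have quad: "(\<Sum>p\<in>I. (\<Sum>c\<in>?S. f p c * z c)\<^sup>2) =
      (\<Sum>s\<in>?S. \<Sum>t\<in>?S. (\<Sum>p\<in>I. f p s * f p t) * z s * z t)" for I :: "'b set" and f :: "'b \<Rightarrow> cell \<Rightarrow> real" and z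
  proof -
    have "(\<Sum>p\<in>I. (\<Sum>c\<in>?S. f p c * z c)\<^sup>2) =
        (\<Sum>p\<in>I. \<Sum>s\<in>?S. \<Sum>t\<in>?S. f p s * f p t * z s * z t)"
      unfolding power2_eq_square sum_product by (intro sum.cong refl) (simp only: mult_ac)
    also have "\<dots> = (\<Sum>s\<in>?S. \<Sum>t\<in>?S. \<Sum>p\<in>I. f p s * f p t * z s * z t)"
      by (subst sum.swap, rule sum.cong[OF refl])+ (rule refl)
    finally show ?thesis
      by (simp add: sum_distrib_right)
  qed
  have "\<exists>d. \<forall>s\<in>?S. \<forall>t\<in>?S. a s t = (\<Sum>w\<in>?S. d w s * d w t)"
  proof (rule psd_decomposition[OF fin])
    show "a s t = a t s" for s t
      unfolding a_def by (simp add: mult.commute)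
    show "0 \<le> (\<Sum>s\<in>?S. \<Sum>t\<in>?S. a s t * z s * z t)" for z
      unfolding a_def quad[symmetric] by (intro sum_nonneg) simp
  qed
  then obtain d where d: "\<And>s t. s \<in> ?S \<Longrightarrow> t \<in> ?S \<Longrightarrow> a s t = (\<Sum>w\<in>?S. d w s * d w t)"
    by blast
  obtain h where h: "bij_betw h {1..m * n} ?S"
    using finite_same_card_bij[of "{1..m * n}" ?S] fin card by auto
  have "P = (\<lambda>x y. \<Sum>w\<in>?S. (\<Sum>c\<in>?S. d w c * (x (fst c) * y (snd c)))\<^sup>2)"
    unfolding P quad a_def[symmetric] by (intro ext sum.cong refl) (simp add: d)
  also have "\<dots> = (\<lambda>x y. \<Sum>p=1..m * n. (\<Sum>c\<in>?S. d (h p) c * (x (fst c) * y (snd c)))\<^sup>2)"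
    by (intro ext sum.reindex_bij_betw[OF h, symmetric])
  finally have "sum_of_squares m n (m * n) P"
    unfolding sum_of_squares_cells_iff by (intro exI[of _ "\<lambda>p. d (h p)"])
  then show ?thesis
    unfolding SOS_rank_def by (rule Least_le)
qed

lemma SOS_rank_le_BSR:
  assumes "SOS m n P"
  shows "SOS_rank m n P \<le> BSR m n"
  unfolding BSR_def
proof (rule Max_ge)
  have "{SOS_rank m n P | P. biquadratic_form m n P \<and> SOS m n P} \<subseteq> {..m * n}"
    using SOS_rank_le by auto
  then show "finite {SOS_rank m n P | P. biquadratic_form m n P \<and> SOS m n P}"
    by (rule finite_subset) simp
  show "SOS_rank m n P \<in> {SOS_rank m n P | P. biquadratic_form m n P \<and> SOS m n P}"
    using assms biquadratic_form_if_sum_of_squares unfolding SOS_def by blast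
qed

lemma sum_of_squares_SOS_rank:
  "SOS m n P \<Longrightarrow> sum_of_squares m n (SOS_rank m n P) P"
  unfolding SOS_def SOS_rank_def by (rule LeastI_ex)

section \<open>Gram vectors of SOS decompositions\<close>

text \<open>On evaluation at e_i +- e_k and e_j +- e_l, the alternating sum keeps only the part odd
  in both signs. Each square contributes twice its summand on the left to that part, and four
  evaluations make the factor 8.\<close>

lemma polarization:
  fixes b :: "nat \<Rightarrow> nat \<Rightarrow> nat \<Rightarrow> real" and m n r :: nat
  defines "v \<equiv> \<lambda>i k s t. of_bool (t = i) + s * of_bool (t = k) :: real"
  assumes P: "P = (\<lambda>x y. \<Sum>p=1..r. (\<Sum>i=1..m. \<Sum>j=1..n. b p i j * x i * y j)\<^sup>2)"
    and "i \<in> {1..m}" "k \<in> {1..m}" "j \<in> {1..n}" "l \<in> {1..n}"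
  shows "(\<Sum>p=1..r. b p i j * b p k l) + (\<Sum>p=1..r. b p i l * b p k j) =
    (P (v i k 1) (v j l 1) - P (v i k 1) (v j l (- 1)) -
     P (v i k (- 1)) (v j l 1) + P (v i k (- 1)) (v j l (- 1))) / 8"
proof -
  have v: "(\<Sum>j=1..n. f j * v j1 j2 t j) = f j1 + t * f j2"
    if "j1 \<in> {1..n}" "j2 \<in> {1..n}" for f j1 j2 t n
  proof -
    have "f j * v j1 j2 t j = (if j = j1 then f j1 else 0) + (if j = j2 then t * f j2 else 0)" for j
      unfolding v_def by (simp add: distrib_left)
    then show ?thesis
      using that by (simp add: sum.distrib)
  qed
  have eval: "(\<Sum>i'=1..m. \<Sum>j'=1..n. b p i' j' * v i k s i' * v j l t j') =
      b p i j + t * b p i l + s * (b p k j + t * b p k l)" for p s t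
  proof -
    have "(\<Sum>i'=1..m. \<Sum>j'=1..n. b p i' j' * v i k s i' * v j l t j') =
        (\<Sum>i'=1..m. (\<Sum>j'=1..n. b p i' j' * v j l t j') * v i k s i')"
      unfolding sum_distrib_right by (intro sum.cong refl) (simp add: mult_ac)
    then show ?thesis
      by (simp only: v[OF assms(5,6)] v[OF assms(3,4)])
  qed
  show ?thesis
    unfolding P eval sum.distrib[symmetric] sum_subtractf[symmetric] sum_divide_distrib
    by (intro sum.cong refl) (simp add: power2_eq_square algebra_simps)
qed

text \<open>The right-hand side of \<open>polarization\<close> depends on \<open>P\<close> alone, so
  an arbitrary decomposition can be compared with a known one.\<close>

lemma gram_swap_unique:
  fixes b c :: "nat \<Rightarrow> nat \<Rightarrow> nat \<Rightarrow> real" and m n r s :: nat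
  assumes "P = (\<lambda>x y. \<Sum>p=1..r. (\<Sum>i=1..m. \<Sum>j=1..n. b p i j * x i * y j)\<^sup>2)"
    and "P = (\<lambda>x y. \<Sum>p=1..s. (\<Sum>i=1..m. \<Sum>j=1..n. c p i j * x i * y j)\<^sup>2)"
    and "i \<in> {1..m}" "k \<in> {1..m}" "j \<in> {1..n}" "l \<in> {1..n}"
  shows "(\<Sum>p=1..r. b p i j * b p k l) + (\<Sum>p=1..r. b p i l * b p k j) =
    (\<Sum>p=1..s. c p i j * c p k l) + (\<Sum>p=1..s. c p i l * c p k j)"
  by (rule trans[OF polarization[OF assms(1,3-6)] polarization[OF assms(2,3-6), symmetric]])

text \<open>
  The hypotheses say that \<open>c\<close> and \<open>d\<close> are linearly independent vectors in the kernel of the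
  skew-symmetric \<open>3 \<times> 3\<close> matrix with upper entries \<open>M\<^sub>1\<^sub>2\<close>, \<open>M\<^sub>1\<^sub>3\<close>, \<open>M\<^sub>2\<^sub>3\<close>.
\<close>
lemma skew_eq_0:
  fixes c\<^sub>1 :: "'a :: idom"
  assumes "c\<^sub>2 * M\<^sub>1\<^sub>2 + c\<^sub>3 * M\<^sub>1\<^sub>3 = 0" "c\<^sub>1 * M\<^sub>1\<^sub>2 = c\<^sub>3 * M\<^sub>2\<^sub>3" "c\<^sub>1 * M\<^sub>1\<^sub>3 + c\<^sub>2 * M\<^sub>2\<^sub>3 = 0"
    and "d\<^sub>2 * M\<^sub>1\<^sub>2 + d\<^sub>3 * M\<^sub>1\<^sub>3 = 0" "d\<^sub>1 * M\<^sub>1\<^sub>2 = d\<^sub>3 * M\<^sub>2\<^sub>3" "d\<^sub>1 * M\<^sub>1\<^sub>3 + d\<^sub>2 * M\<^sub>2\<^sub>3 = 0"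
    and "c\<^sub>1 * d\<^sub>2 \<noteq> c\<^sub>2 * d\<^sub>1 \<or> c\<^sub>1 * d\<^sub>3 \<noteq> c\<^sub>3 * d\<^sub>1 \<or> c\<^sub>2 * d\<^sub>3 \<noteq> c\<^sub>3 * d\<^sub>2"
  shows "M\<^sub>1\<^sub>2 = 0" "M\<^sub>1\<^sub>3 = 0" "M\<^sub>2\<^sub>3 = 0"
proof -
  \<comment> \<open>Every entry is annihilated by each 2 x 2 minor of the pair \<open>c\<close>,
    \<open>d\<close>, and one minor is nonzero.\<close>
  have *: "x * (c\<^sub>1 * d\<^sub>2 - c\<^sub>2 * d\<^sub>1) = 0" "x * (c\<^sub>1 * d\<^sub>3 - c\<^sub>3 * d\<^sub>1) = 0" "x * (c\<^sub>2 * d\<^sub>3 - c\<^sub>3 * d\<^sub>2) = 0"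
    if "x \<in> {M\<^sub>1\<^sub>2, M\<^sub>1\<^sub>3, M\<^sub>2\<^sub>3}" for x
    using that assms(1-6) by (auto; algebra)+
  show "M\<^sub>1\<^sub>2 = 0" "M\<^sub>1\<^sub>3 = 0" "M\<^sub>2\<^sub>3 = 0"
    using *[of M\<^sub>1\<^sub>2] *[of M\<^sub>1\<^sub>3] *[of M\<^sub>2\<^sub>3] assms(7) by auto
qed

text \<open>Bessel's inequality for each standard basis vector, summed over the coordinates.\<close>

lemma orthonormal_card_le:
  fixes v :: "'a \<Rightarrow> 'b \<Rightarrow> real"
  assumes "finite I" "finite T"
    and orth: "\<And>c d. c \<in> T \<Longrightarrow> d \<in> T \<Longrightarrow> (\<Sum>p\<in>I. v c p * v d p) = of_bool (c = d)"
  shows "card T \<le> card I"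
proof -
  have bessel: "(\<Sum>c\<in>T. (v c p)\<^sup>2) \<le> 1" if p: "p \<in> I" for p
  proof -
    let ?S = "\<Sum>c\<in>T. (v c p)\<^sup>2"
    \<comment> \<open>The projection of the \<open>p\<close>-th basis vector onto the span of the
      family; its \<open>p\<close>-th entry and its squared norm both equal
      \<open>?S\<close>.\<close>
    let ?w = "\<lambda>q. \<Sum>c\<in>T. v c p * v c q"
    have "(\<Sum>q\<in>I. (?w q)\<^sup>2) = (\<Sum>q\<in>I. \<Sum>c\<in>T. \<Sum>d\<in>T. v c p * v d p * (v c q * v d q))"
      unfolding power2_eq_square sum_product by (simp add: mult_ac)
    also have "\<dots> = (\<Sum>c\<in>T. \<Sum>d\<in>T. \<Sum>q\<in>I. v c p * v d p * (v c q * v d q))"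
      by (subst sum.swap, rule sum.cong[OF refl])+ (rule refl)
    also have "\<dots> = (\<Sum>c\<in>T. \<Sum>d\<in>T. v c p * v d p * of_bool (c = d))"
      by (simp add: sum_distrib_left[symmetric] orth)
    also have "\<dots> = ?S"
      using \<open>finite T\<close>
      by (simp add: of_bool_def if_distrib sum.delta power2_eq_square cong: if_cong)
    finally have w: "(\<Sum>q\<in>I. (?w q)\<^sup>2) = ?S" .
    have "0 \<le> (\<Sum>q\<in>I. (of_bool (q = p) - ?w q)\<^sup>2)"
      by (intro sum_nonneg) simp
    also have "\<dots> = (\<Sum>q\<in>I. of_bool (q = p) - 2 * (if q = p then ?w q else 0) + (?w q)\<^sup>2)"
      by (intro sum.cong refl) (auto simp: power2_diff)
    also have "\<dots> = 1 - 2 * ?S + ?S"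
      using p \<open>finite I\<close> unfolding sum.distrib sum_subtractf w sum_distrib_left[symmetric]
      by (simp add: of_bool_def sum.delta power2_eq_square)
    finally show ?thesis by simp
  qed
  have "real (card T) = (\<Sum>c\<in>T. \<Sum>p\<in>I. (v c p)\<^sup>2)"
    by (simp add: power2_eq_square orth)
  also have "\<dots> = (\<Sum>p\<in>I. \<Sum>c\<in>T. (v c p)\<^sup>2)"
    by (rule sum.swap)
  also have "\<dots> \<le> (\<Sum>p\<in>I. 1)"
    by (intro sum_mono bessel)
  finally show ?thesis by simp
qed

section \<open>Graphs with three columns\<close>

lemma C4_free_three_columns:
  assumes E: "E \<subseteq> cells m 3" and C4: "\<not> contains_C4 E"
  shows "card E \<le> m + 3"
    and "card E = m + 3 \<Longrightarrow> i \<in> {1..m} \<Longrightarrow> \<exists>j\<in>{1..3}. (i, j) \<in> E"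
    and "card E = m + 3 \<Longrightarrow> i \<in> {1..m} \<Longrightarrow> \<exists>j\<in>{1..3}. (i, j) \<notin> E"
    and "card E = m + 3 \<Longrightarrow> j \<in> {1..3} \<Longrightarrow> l \<in> {1..3} \<Longrightarrow> j \<noteq> l \<Longrightarrow>
      \<exists>i\<in>{1..m}. (i, j) \<in> E \<and> (i, l) \<in> E"
proof -
  have three: "{1..3} = {1, 2, 3::nat}"
    by auto
  define w where "w i = (of_bool ((\<forall>j\<in>{1..3}. (i, j) \<in> E) \<or> (\<forall>j\<in>{1..3}. (i, j) \<notin> E)) :: nat)" for i
  define M where "M j l = {i\<in>{1..m}. (i, j) \<in> E \<and> (i, l) \<in> E}" for j l
  have M_le: "card (M j l) \<le> 1" if "j \<noteq> l" for j l
    using C4 that unfolding contains_C4_def M_def One_nat_def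
    by (subst card_le_Suc0_iff_eq) auto
  have "E = (SIGMA i:{1..m}. {j\<in>{1..3}. (i, j) \<in> E})"
    using E unfolding cells_def by auto
  then have "card E = card (SIGMA i:{1..m}. {j\<in>{1..3}. (i, j) \<in> E})"
    by simp
  also have "\<dots> = (\<Sum>i=1..m. card {j\<in>{1..3}. (i, j) \<in> E})"
    by (intro card_SigmaI) auto
  also have "\<dots> = (\<Sum>i=1..m. \<Sum>j\<in>{1..3}. of_bool ((i, j) \<in> E))"
    by (intro sum.cong refl) (simp add: of_bool_def sum.If_cases Int_def)
  finally have "card E + (\<Sum>i=1..m. w i) = (\<Sum>i=1..m. (\<Sum>j\<in>{1..3}. of_bool ((i, j) \<in> E)) + w i)"
    by (simp add: sum.distrib)
  also have "\<dots> = (\<Sum>i=1..m. 1 + of_bool (i \<in> M 1 2) + of_bool (i \<in> M 1 3) + of_bool (i \<in> M 2 3))"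
    unfolding w_def M_def three by (intro sum.cong refl) auto
  also have "\<dots> = m + card (M 1 2) + card (M 1 3) + card (M 2 3)"
    unfolding sum.distrib by (auto simp: M_def of_bool_def sum.If_cases Int_def intro!: arg_cong[of _ _ card])
  \<comment> \<open>A row with \<open>d\<close> edges contains \<open>d choose 2\<close> of the three column pairs, and
    \<open>1 + (d choose 2) - d\<close> is 1 for \<open>d = 0, 3\<close> and 0 for \<open>d = 1, 2\<close>.\<close>
  finally have count: "card E + (\<Sum>i=1..m. w i) = m + card (M 1 2) + card (M 1 3) + card (M 2 3)" .
  have le: "card (M 1 2) \<le> 1" "card (M 1 3) \<le> 1" "card (M 2 3) \<le> 1"
    by (rule M_le, simp)+
  show "card E \<le> m + 3"
    using count le by linarith
  assume eq: "card E = m + 3"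
  then have w: "(\<Sum>i=1..m. w i) = 0" and M: "card (M 1 2) = 1" "card (M 1 3) = 1" "card (M 2 3) = 1"
    using count le by linarith+
  show "\<exists>j\<in>{1..3}. (i, j) \<in> E" "\<exists>j\<in>{1..3}. (i, j) \<notin> E" if "i \<in> {1..m}"
    using w that by (auto simp: w_def split: if_splits)
  have "M 1 2 \<noteq> {}" "M 1 3 \<noteq> {}" "M 2 3 \<noteq> {}"
    using M by force+
  then show "\<exists>i\<in>{1..m}. (i, j) \<in> E \<and> (i, l) \<in> E" if "j \<in> {1..3}" "l \<in> {1..3}" "j \<noteq> l"
    using that unfolding three M_def by auto
qed

section \<open>Upper bound for \<open>z_L 6 3\<close>\<close>

lemma card_two_edges_le:
  assumes aug: "aug_bipartite 6 3 E1 E2" and card: "card E1 = 9"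
    and S: "cond_S E1 E2" and W1: "cond_W1 E1" and c2: "cond_2 E1 E2" and c3: "cond_3 E1 E2"
  shows "card E2 \<le> 2"
proof (rule ccontr)
  assume "\<not> card E2 \<le> 2"
  then have E2: "card E2 \<ge> 3"
    by simp
  then have "finite E2"
    by (metis card.infinite not_numeral_le_zero)
  have E1: "E1 \<subseteq> cells 6 3" "\<not> contains_C4 E1"
    using aug W1 unfolding aug_bipartite_def cond_W1_def by auto
  have edge: "e \<subseteq> cells 6 3" "card e = 2" if "e \<in> E2" for e
    using aug that unfolding aug_bipartite_def by auto
  have "card E1 = 6 + 3"
    using card by simp
  note rows = C4_free_three_columns(2-4)[OF E1 this]
  define O' where "O' = occupied E1 E2"
  define U where "U = cells 6 3 - O'"
  have cells: "finite (cells 6 3)" "card (cells 6 3) = 18"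
    unfolding cells_def by simp_all
  have "finite E1"
    using E1 cells finite_subset by blast
  have "card (\<Union>E2) = (\<Sum>e\<in>E2. card e)"
  proof (rule card_Union_disjoint)
    show "pairwise disjnt E2"
      using S unfolding cond_S_def pairwise_def disjnt_def by blast
    show "finite e" if "e \<in> E2" for e
      using edge[OF that] by (metis card.infinite zero_neq_numeral)
  qed
  then have "card (\<Union>E2) \<ge> 6"
    using edge E2 by simp
  moreover have "\<Union>E2 \<subseteq> cells 6 3"
    using edge(1) by (rule Union_least)
  then have "finite (\<Union>E2)"
    using cells(1) by (rule finite_subset)
  moreover have "E1 \<inter> \<Union>E2 = {}"
    using S unfolding cond_S_def by blast
  ultimately have "card O' \<ge> 15"
    using card \<open>finite E1\<close> unfolding O'_def occupied_def by (subst card_Un_disjoint) auto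
  moreover have "O' \<subseteq> cells 6 3"
    using edge E1 unfolding O'_def occupied_def by blast
  ultimately have card_U: "card U \<le> 3" and fin_U: "finite U"
    using cells unfolding U_def by (auto simp: card_Diff_subset finite_subset)
  \<comment> \<open>Exhibiting three unoccupied cells determines all of \<open>U\<close>.\<close>
  have U: "U \<subseteq> {a, b, c}" if "{a, b, c} \<subseteq> U" "card {a, b, c} = 3" for a b c
    using card_seteq[OF fin_U that(1)] card_U that by simp
  have E1_O: "c \<in> O'" if "c \<in> E1" for c
    using that unfolding O'_def occupied_def by blast

  have "\<forall>j\<in>{1..3}. \<exists>i\<in>{1..6}. \<forall>l\<in>{1..3} - {j}. (i, l) \<in> E1"
  proof
    fix j :: nat assume "j \<in> {1..3}"
    then have "card ({1..3} - {j}) = 2"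
      by simp
    then obtain k l where kl: "{1..3} - {j} = {k, l}" "k \<noteq> l"
      unfolding card_2_iff by blast
    then have "{k, l} \<subseteq> {1..3}"
      by (metis Diff_subset)
    then show "\<exists>i\<in>{1..6}. \<forall>l\<in>{1..3} - {j}. (i, l) \<in> E1"
      using rows(3)[of k l] \<open>k \<noteq> l\<close> unfolding kl(1) by simp
  qed
  \<comment> \<open>\<open>D j\<close> is the unique row whose only cell outside \<open>E1\<close> lies in column \<open>j\<close>; every row in the set
    \<open>T\<close> below contains a single 1-edge.\<close>
  then obtain D where D_row: "\<And>j. j \<in> {1..3} \<Longrightarrow> D j \<in> {1..6}"
    and D: "\<And>j l. j \<in> {1..3} \<Longrightarrow> l \<in> {1..3} \<Longrightarrow> l \<noteq> j \<Longrightarrow> (D j, l) \<in> E1"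
    by (metis Diff_iff singletonD)
  have D_out: "(D j, j) \<notin> E1" if "j \<in> {1..3}" for j
    using rows(2)[of "D j"] D_row[OF that] D[OF that] by metis
  have D_eq: "D j = D k \<longleftrightarrow> j = k" if "j \<in> {1..3}" "k \<in> {1..3}" for j k
    using D_out D that by metis
  have third: "\<exists>t\<in>{1..3}. t \<noteq> j \<and> t \<noteq> (l::nat)" for j l
    unfolding Bex_def atLeastAtMost_iff by presburger
  have D_unique: "\<exists>t\<in>{1..3}. i = D t"
    if "(i, j) \<in> E1" "(i, l) \<in> E1" "j \<noteq> l" for i j l
  proof -
    have jl: "j \<in> {1..3}" "l \<in> {1..3}"
      using that E1 unfolding cells_def by auto
    obtain t where t: "t \<in> {1..3}" "t \<noteq> j" "t \<noteq> l"
      using third by blast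
    then have "(D t, j) \<in> E1" "(D t, l) \<in> E1"
      using D jl by auto
    then have "i = D t"
      using that E1(2) unfolding contains_C4_def by blast
    then show ?thesis
      using t by blast
  qed
  define T where "T = {1..6} - D ` {1..3}"
  have card_T: "card T = 3"
    unfolding T_def using D_row D_eq
    by (subst card_Diff_subset) (auto simp: card_image inj_on_def)
  have T_other: "\<exists>k\<in>T. k \<noteq> s \<and> k \<noteq> t" for s t
  proof (rule ccontr)
    assume "\<not> ?thesis"
    then have "T \<subseteq> {s, t}" by blast
    then have "card T \<le> card {s, t}"
      by (intro card_mono) auto
    also have "\<dots> \<le> 2"
      by (simp add: card_insert_if)
    finally show False
      using card_T by simp
  qed
  have T_D: "s \<noteq> D j" if "s \<in> T" "j \<in> {1..3}" for s j
    using that unfolding T_def by blast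

  have no3: False if "{(i,j), (p,q)} \<in> E2" "k \<noteq> i" "k \<noteq> p" "l \<noteq> j" "l \<noteq> q"
    "{(k,l), (k,j), (k,q), (i,l), (p,l)} \<subseteq> O'" for i j p q k l
    using c3 that unfolding cond_3_def O'_def by blast
  have no2: "(i, q) \<notin> O' \<or> (p, j) \<notin> O'" if "{(i,j), (p,q)} \<in> E2" "i \<noteq> p" "j \<noteq> q" for i j p q
  proof -
    have "opposite_cells {(i,j), (p,q)} \<subseteq> {(i,q), (p,j)}"
      unfolding opposite_cells_def by (auto simp: doubleton_eq_iff)
    moreover have "nondegenerate {(i,j), (p,q)}"
      unfolding nondegenerate_def using that by blast
    ultimately show ?thesis
      using c2 that unfolding cond_2_def O'_def by blast
  qed
  have half: "c \<in> cells 6 3 \<and> c \<notin> E1" if "c \<in> e" "e \<in> E2" for c e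
    using that edge S unfolding cond_S_def by blast

  show False
  proof (cases "\<exists>j\<in>{1..3}. (D j, j) \<in> O'")
    case True
    then obtain j where j: "j \<in> {1..3}" "(D j, j) \<in> O'" by blast
    then obtain e where e: "e \<in> E2" "(D j, j) \<in> e"
      using D_out unfolding O'_def occupied_def by blast
    obtain a b where ab: "e = {a, b}" "a \<noteq> b"
      using edge(2)[OF e(1)] by (auto simp: card_2_iff)
    then obtain c where c: "e = {(D j, j), c}" "c \<noteq> (D j, j)"
      using e by blast
    obtain s l where sl: "c = (s, l)" by (cases c)
    have e_sl: "{(D j, j), (s, l)} \<in> E2" and ne: "(s, l) \<noteq> (D j, j)"
      using e c sl by auto
    have sl_half: "s \<in> {1..6}" "l \<in> {1..3}" "(s, l) \<notin> E1"
      using half[of "(s, l)" e] e c sl unfolding cells_def by auto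
    \<comment> \<open>Otherwise the other half is \<open>(D l, l)\<close>, and both opposite cells
      \<open>(D j, l)\<close> and \<open>(D l, j)\<close> are 1-edges, against Condition 2.\<close>
    have "s \<in> T"
    proof (rule ccontr)
      assume "s \<notin> T"
      then obtain k where k: "k \<in> {1..3}" "s = D k"
        using sl_half unfolding T_def by blast
      then have "k = l"
        using D sl_half by blast
      then have "l \<noteq> j"
        using ne k by blast
      then show False
        using no2[OF e_sl] D[of j l] D[of l j] D_eq[of j l] j sl_half k \<open>k = l\<close> E1_O by auto
    qed
    \<comment> \<open>The column of a 1-edge in row \<open>s\<close>; it turns out that
      \<open>j\<close>, \<open>l\<close>, \<open>c\<close> are the three columns.\<close>
    obtain c where c: "c \<in> {1..3}" "(s, c) \<in> E1"
      using rows(1)[of s] sl_half by auto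
    have "c \<noteq> j"
    proof
      assume "c = j"
      then have "l \<noteq> j"
        using c sl_half by blast
      then show False
        using no2[OF e_sl] D[of j l] j sl_half c \<open>c = j\<close> E1_O T_D \<open>s \<in> T\<close> by metis
    qed
    have "c \<noteq> l"
      using c sl_half by blast
    \<comment> \<open>The cells \<open>(D j, c)\<close> and \<open>(s, c)\<close> are 1-edges, so
      Condition 3 excludes any further row occupied in columns \<open>c\<close>, \<open>j\<close>
      and \<open>l\<close>.\<close>
    have no_full: False if "k \<noteq> D j" "k \<noteq> s" "(k, c) \<in> O'" "(k, j) \<in> O'" "(k, l) \<in> O'" for k
      using no3[OF e_sl that(1,2) \<open>c \<noteq> j\<close> \<open>c \<noteq> l\<close>] that D[of j c] j c \<open>c \<noteq> j\<close> E1_O by auto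
    have "l \<noteq> j"
    proof
      assume "l = j"
      obtain t where t: "t \<in> {1..3}" "t \<noteq> j" "t \<noteq> c"
        using third by blast
      then show False
        using no_full[of "D t"] D_eq[of t j] T_D[OF \<open>s \<in> T\<close>] D[of t] j c \<open>l = j\<close> E1_O by metis
    qed
    \<comment> \<open>Condition 2 applies because \<open>(D j, l)\<close> is a 1-edge. The next two
      cells are unoccupied because rows \<open>D l\<close> and \<open>D c\<close> would otherwise be
      full.\<close>
    have "(s, j) \<notin> O'"
      using no2[OF e_sl] T_D[OF \<open>s \<in> T\<close> j(1)] \<open>l \<noteq> j\<close> D[of j l] j sl_half E1_O by metis
    moreover have "(D l, l) \<notin> O'"
      using no_full[of "D l"] D_eq[of l j] \<open>l \<noteq> j\<close> \<open>c \<noteq> l\<close> T_D[OF \<open>s \<in> T\<close>] D[of l] j c sl_half E1_O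
      by metis
    moreover have "(D c, c) \<notin> O'"
      using no_full[of "D c"] D_eq[of c j] \<open>c \<noteq> j\<close> \<open>c \<noteq> l\<close> T_D[OF \<open>s \<in> T\<close>] D[of c] j c sl_half E1_O
      by metis
    ultimately have "{(s, j), (D l, l), (D c, c)} \<subseteq> U"
      using sl_half j c D_row unfolding U_def cells_def by auto
    moreover have "card {(s, j), (D l, l), (D c, c)} = 3"
      using \<open>l \<noteq> j\<close> \<open>c \<noteq> j\<close> \<open>c \<noteq> l\<close> by auto
    ultimately have U_sub: "U \<subseteq> {(s, j), (D l, l), (D c, c)}"
      by (rule U)
    obtain k where k: "k \<in> T" "k \<noteq> s"
      using T_other by blast
    have "(k, t) \<in> O'" if "t \<in> {1..3}" for t
    proof (rule ccontr)
      assume "(k, t) \<notin> O'"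
      then have "(k, t) \<in> U"
        using k that unfolding U_def cells_def T_def by auto
      then show False
        using U_sub k T_D[OF k(1)] sl_half c by auto
    qed
    then show False
      using no_full[of k] k T_D j c sl_half by blast
  next
    case False
    have "{(D 1, 1), (D 2, 2), (D 3, 3)} \<subseteq> U"
      using False D_row unfolding U_def cells_def by auto
    then have "U \<subseteq> {(D 1, 1), (D 2, 2), (D 3, 3)}"
      by (rule U) simp
    then have O': "c \<in> O'" if "c \<in> cells 6 3" "\<And>j. j \<in> {1..3} \<Longrightarrow> c \<noteq> (D j, j)" for c
      using that(1) that(2)[of 1] that(2)[of 2] that(2)[of 3] unfolding U_def by auto
    obtain e where e: "e \<in> E2"
      using E2 by (metis card.empty ex_in_conv not_numeral_le_zero)
    obtain a b where ab: "e = {a, b}" "a \<noteq> b"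
      using edge(2)[OF e] by (auto simp: card_2_iff)
    obtain s l t q where st: "a = (s, l)" "b = (t, q)"
      by (cases a, cases b)
    \<comment> \<open>In a row \<open>D t\<close> the only cell outside \<open>E1\<close> is
      unoccupied, so no half of a 2-edge lies there.\<close>
    have single: "i \<in> T \<and> j \<in> {1..3}" if "(i, j) \<in> e" for i j
    proof -
      have ij: "i \<in> {1..6}" "j \<in> {1..3}" "(i, j) \<notin> E1"
        using half[OF that e] unfolding cells_def by auto
      have "(i, j) \<in> O'"
        using that e unfolding O'_def occupied_def by blast
      then have "i \<notin> D ` {1..3}"
        using False D ij by blast
      then show ?thesis
        using ij unfolding T_def by blast
    qed
    then have s: "s \<in> T" "l \<in> {1..3}" and t: "t \<in> T" "q \<in> {1..3}"
      using ab st by auto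
    have T_O: "(i, j) \<in> O'" if "i \<in> T" "j \<in> {1..3}" for i j
      using that T_D[OF that(1)] by (intro O') (auto simp: T_def cells_def)
    \<comment> \<open>All rows of \<open>T\<close> are full, so Condition 3 fails at a cell
      \<open>(k, c)\<close> avoiding the rows and columns of \<open>e\<close>.\<close>
    obtain k where k: "k \<in> T" "k \<noteq> s" "k \<noteq> t"
      using T_other by blast
    obtain c where c: "c \<in> {1..3}" "c \<noteq> l" "c \<noteq> q"
      using third by blast
    show False
      using no3[of s l t q k c] e ab st k c s t T_O by auto
  qed
qed

section \<open>Witness graphs\<close>

text \<open>Rows 1 to 3 realise the three column pairs and rows 4 to 6 hold one edge each, as
  equality in the edge bound requires.\<close>

definition witness_E1 :: "cell set" where
  "witness_E1 = {(1,1), (1,2), (2,1), (2,3), (3,2), (3,3), (4,1), (5,2), (6,3)}"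

definition witness_E2 :: "cell set set" where
  "witness_E2 = {{(4,2), (4,3)}, {(5,1), (5,3)}, {(6,1), (6,2)}}"

text \<open>The second set of 2-edges satisfies the original conditions and yields the lower bound on \<open>z\<^sub>L\<close>.\<close>

definition witness_E2' :: "cell set set" where
  "witness_E2' = {{(1,3), (4,2)}, {(5,1), (6,1)}}"

lemmas witness_defs = witness_E1_def witness_E2_def witness_E2'_def

lemma card_witness: "card witness_E1 = 9" "card witness_E2 = 3" "card witness_E2' = 2"
  unfolding witness_defs by (simp_all add: doubleton_eq_iff)

lemma witness_E1_subset: "witness_E1 \<subseteq> cells 6 3"
  unfolding witness_defs cells_def by simp

lemma witness_E1_C4_free: "\<not> contains_C4 witness_E1"
proof -
  \<comment> \<open>Quantifiers bounded by the explicit edge set let simplification check all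
    cases.\<close>
  have "\<forall>(i, j)\<in>witness_E1. \<forall>(i', l)\<in>witness_E1. i = i' \<longrightarrow> j \<noteq> l \<longrightarrow>
      (\<forall>(k, j')\<in>witness_E1. j = j' \<longrightarrow> i \<noteq> k \<longrightarrow> (k, l) \<notin> witness_E1)"
    unfolding witness_defs by simp
  then have "(k, l) \<notin> witness_E1"
    if "(i, j) \<in> witness_E1" "(i, l) \<in> witness_E1" "(k, j) \<in> witness_E1" "i \<noteq> k" "j \<noteq> l" for i j k l
    using that by fast
  then show ?thesis
    unfolding contains_C4_def insert_subset by blast
qed

lemma zarankiewicz_6_3: "zarankiewicz 6 3 = 9"
  unfolding zarankiewicz_def
proof (rule Max_eqI)
  have "{card E | E. E \<subseteq> cells 6 3 \<and> \<not> contains_C4 E} \<subseteq> {..9}"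
    using C4_free_three_columns(1)[of _ 6] by auto
  then show "finite {card E | E. E \<subseteq> cells 6 3 \<and> \<not> contains_C4 E}"
    by (rule finite_subset) simp
  show "y \<le> 9" if "y \<in> {card E | E. E \<subseteq> cells 6 3 \<and> \<not> contains_C4 E}" for y
    using that C4_free_three_columns(1)[of _ 6] by auto
  show "9 \<in> {card E | E. E \<subseteq> cells 6 3 \<and> \<not> contains_C4 E}"
    using card_witness(1)[symmetric] witness_E1_subset witness_E1_C4_free by blast
qed

lemma limited_6_3_iff: "limited 6 3 E \<longleftrightarrow> card E = 9"
  unfolding limited_def zarankiewicz_6_3 by simp

text \<open>Leaving \<open>Q\<close> open serves the maxima in both \<open>z_wL\<close> and
  \<open>z_L\<close>.\<close>

lemma finite_aug_bipartite: "finite {card E1 + card E2 | E1 E2. aug_bipartite m n E1 E2 \<and> Q E1 E2}"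
proof (rule finite_subset)
  show "{card E1 + card E2 | E1 E2. aug_bipartite m n E1 E2 \<and> Q E1 E2} \<subseteq>
      (\<lambda>(E1, E2). card E1 + card E2) ` (Pow (cells m n) \<times> Pow (Pow (cells m n)))"
    unfolding aug_bipartite_def by (force simp: image_iff)
  show "finite ((\<lambda>(E1, E2). card E1 + card E2) ` (Pow (cells m n) \<times> Pow (Pow (cells m n))))"
    by (simp add: cells_def)
qed

lemma witness_aug_bipartite: "aug_bipartite 6 3 witness_E1 witness_E2" "aug_bipartite 6 3 witness_E1 witness_E2'"
  unfolding aug_bipartite_def witness_defs cells_def by simp_all

lemma witness_cond_S: "cond_S witness_E1 witness_E2" "cond_S witness_E1 witness_E2'"
  unfolding cond_S_def witness_defs by simp_all

lemma witness_weak_admissible: "weak_admissible witness_E1 witness_E2"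
proof -
  have degenerate: "\<not> nondegenerate e" if "e \<in> witness_E2" for e
    using that unfolding nondegenerate_def witness_E2_def by (auto simp: doubleton_eq_iff)
  have "parcs (dependency_graph witness_E1 witness_E2) = {}"
    using degenerate unfolding dependency_graph_def by auto
  then have "cond_W2 witness_E1 witness_E2"
    unfolding cond_W2_def pre_digraph.cycle_def pre_digraph.awalk_def by auto
  moreover have "cond_W2' witness_E1 witness_E2"
    using degenerate unfolding cond_W2'_def by blast
  moreover have "cond_W3 witness_E1 witness_E2"
  proof -
    have "{{c} | c. c \<in> witness_E1} = (\<lambda>c. {c}) ` witness_E1"
      by auto
    then show ?thesis
      unfolding cond_W3_def occupied_def
      by (simp add: witness_defs vertex_disjoint_def pair_opposite_cells_def)
  qed
  ultimately show ?thesis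
    unfolding weak_admissible_def cond_W1_def
    using witness_cond_S witness_E1_C4_free by blast
qed

section \<open>The original conditions and the value of \<open>z_L 6 3\<close>\<close>

lemma witness_E2'_cases:
  assumes "{(i,j), (k,l)} \<in> witness_E2'"
  obtains "i = 1" "j = 3" "k = 4" "l = 2" | "i = 4" "j = 2" "k = 1" "l = 3"
    | "i = 5" "j = 1" "k = 6" "l = 1" | "i = 6" "j = 1" "k = 5" "l = 1"
  using assms unfolding witness_E2'_def insert_iff doubleton_eq_iff prod.inject by blast

lemma witness_occupied:
  "occupied witness_E1 witness_E2' = {(1,1), (1,2), (1,3), (2,1), (2,3), (3,2), (3,3),
     (4,1), (4,2), (5,1), (5,2), (6,1), (6,3)}"
  unfolding occupied_def witness_defs by (simp add: insert_commute)

text \<open>The only nondegenerate 2-edge has the unoccupied opposite cell (4,3).\<close>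

lemma witness_cond_2: "cond_2 witness_E1 witness_E2'"
proof -
  have "(i,l) \<notin> occupied witness_E1 witness_E2' \<or> (k,j) \<notin> occupied witness_E1 witness_E2'"
    if "{(i,j), (k,l)} \<in> witness_E2'" "i \<noteq> k" "j \<noteq> l" for i j k l
    using that(1) by (rule witness_E2'_cases) (use that in \<open>simp_all add: witness_occupied\<close>)
  then show ?thesis
    unfolding cond_2_def nondegenerate_def opposite_cells_def by blast
qed

text \<open>The first 2-edge would need a full row other than 1 and 4; for the second, rows 5 and 6
  share no occupied column besides 1.\<close>

lemma witness_cond_3: "cond_3 witness_E1 witness_E2'"
proof -
  have False
    if e: "{(i,j), (p,q)} \<in> witness_E2'" and ne: "l \<noteq> j" "l \<noteq> q"
      and O: "(k,j) \<in> occupied witness_E1 witness_E2'" "(k,q) \<in> occupied witness_E1 witness_E2'"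
        "(k,l) \<in> occupied witness_E1 witness_E2'"
        "(i,l) \<in> occupied witness_E1 witness_E2'" "(p,l) \<in> occupied witness_E1 witness_E2'"
      and k: "k \<noteq> i" "k \<noteq> p"
    for i j p q k l
    using e by (rule witness_E2'_cases) (use ne O k in \<open>auto simp: witness_occupied\<close>)
  then show ?thesis
    unfolding cond_3_def insert_subset by blast
qed

lemma z_L_6_3: "z_L 6 3 = 11"
  unfolding z_L_def
proof (rule Max_eqI[OF finite_aug_bipartite])
  show "y \<le> 11" if "y \<in> {card E1 + card E2 | E1 E2. aug_bipartite 6 3 E1 E2 \<and> limited 6 3 E1 \<and>
      cond_S E1 E2 \<and> cond_W1 E1 \<and> cond_2 E1 E2 \<and> cond_3 E1 E2}" for y
    using that card_two_edges_le unfolding limited_6_3_iff by fastforce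
  show "11 \<in> {card E1 + card E2 | E1 E2. aug_bipartite 6 3 E1 E2 \<and> limited 6 3 E1 \<and>
      cond_S E1 E2 \<and> cond_W1 E1 \<and> cond_2 E1 E2 \<and> cond_3 E1 E2}"
    using witness_aug_bipartite(2) witness_cond_S(2) witness_cond_2 witness_cond_3 witness_E1_C4_free
      card_witness unfolding limited_6_3_iff cond_W1_def
    by (intro CollectI exI[of _ witness_E1] exI[of _ "witness_E2'"]) simp
qed

section \<open>A form of SOS rank 12\<close>

text \<open>
  The twelve edges of the weak admissible witness are numbered; \<open>label i j\<close> is the number of the edge
  through the cell \<open>(i, j)\<close>, and 0 if the cell is unoccupied.
\<close>

definition label :: "nat \<Rightarrow> nat \<Rightarrow> nat" where
  "label i j = [[1, 2, 0], [3, 0, 4], [0, 5, 6], [7, 10, 10], [11, 8, 11], [12, 12, 9]] ! (i - 1) ! (j - 1)"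

text \<open>
  Row \<open>i\<close> lists the coefficients of the linear relation among the cells of row \<open>i\<close>: an unoccupied
  cell has zero coefficient vector, and the halves of a 2-edge have equal ones.
\<close>

definition row_relation :: "nat \<Rightarrow> nat \<Rightarrow> real" where
  "row_relation i j =
     [[0, 0, 1], [0, 1, 0], [1, 0, 0], [0, 1, -1], [1, 0, -1], [1, -1, 0]] ! (i - 1) ! (j - 1)"

text \<open>A 1-edge contributes the square of its monomial, a 2-edge the square of the sum of its
  two monomials. Starting at p = 1 drops the unoccupied cells, labelled 0.\<close>

definition witness_form :: form where
  "witness_form = (\<lambda>x y. \<Sum>p=1..12. (\<Sum>i=1..6. \<Sum>j=1..3. of_bool (label i j = p) * x i * y j)\<^sup>2)"

lemma row_cases:
  assumes "i \<in> {1..6}"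
  obtains "i = 1" | "i = 2" | "i = 3" | "i = 4" | "i = 5" | "i = (6::nat)"
  using assms unfolding atLeastAtMost_iff by linarith

lemma column_cases:
  assumes "j \<in> {1..3}"
  obtains "j = 1" | "j = 2" | "j = (3::nat)"
  using assms unfolding atLeastAtMost_iff by linarith

lemma label_le: "i \<in> {1..6} \<Longrightarrow> j \<in> {1..3} \<Longrightarrow> label i j \<le> 12"
  by (erule row_cases; erule column_cases; simp add: label_def)

lemma label_row: "i \<in> {1..6} \<Longrightarrow> j \<in> {1..3} \<Longrightarrow> k \<in> {1..6} \<Longrightarrow> l \<in> {1..3} \<Longrightarrow>
    label i j = label k l \<Longrightarrow> label i j \<noteq> 0 \<Longrightarrow> i = k"
  by (erule row_cases; erule column_cases; erule row_cases; erule column_cases; simp add: label_def)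

lemma row_relation_independent:
  "i \<in> {1..6} \<Longrightarrow> k \<in> {1..6} \<Longrightarrow> i \<noteq> k \<Longrightarrow>
     row_relation i 1 * row_relation k 2 \<noteq> row_relation i 2 * row_relation k 1 \<or>
     row_relation i 1 * row_relation k 3 \<noteq> row_relation i 3 * row_relation k 1 \<or>
     row_relation i 2 * row_relation k 3 \<noteq> row_relation i 3 * row_relation k 2"
  by (erule row_cases; erule row_cases; simp add: row_relation_def)

lemma sum_upto_3: "(\<Sum>j=1..3. f j) = f 1 + f 2 + f (3::nat)"
  by (simp add: numeral_3_eq_3 numeral_2_eq_2)

section \<open>Rigidity of the Gram matrix and the rank bound\<close>

lemma witness_form_gram:
  fixes b :: "nat \<Rightarrow> nat \<Rightarrow> nat \<Rightarrow> real"
  assumes P: "witness_form = (\<lambda>x y. \<Sum>p=1..r. (\<Sum>i=1..6. \<Sum>j=1..3. b p i j * x i * y j)\<^sup>2)"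
    and i: "i \<in> {1..6}" and k: "k \<in> {1..6}" and j: "j \<in> {1..3}" and l: "l \<in> {1..3}"
  shows "(\<Sum>p=1..r. b p i j * b p k l) = of_bool (label i j = label k l \<and> label i j \<noteq> 0)"
proof -
  define g where "g i j k l = (\<Sum>p=1..r. b p i j * b p k l)" for i j k l
  define h where "h i j k l = (of_bool (label i j = label k l \<and> label i j \<noteq> 0) :: real)" for i j k l
  have h: "(\<Sum>p=1..12. of_bool (label i j = p) * of_bool (label k l = p)) = h i j k l"
    if "i \<in> {1..6}" "j \<in> {1..3}" for i j k l
  proof -
    have "(\<Sum>p=1..12. of_bool (label i j = p) * of_bool (label k l = p) :: real) =
        (\<Sum>p=1..12. if p = label i j then of_bool (label k l = label i j) else 0)"
      by (intro sum.cong refl) auto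
    also have "\<dots> = h i j k l"
      using label_le[OF that] unfolding h_def by (auto simp: sum.delta)
    finally show ?thesis .
  qed
  have polar: "g i j k l + g i l k j = h i j k l + h i l k j"
    if ik: "i \<in> {1..6}" "k \<in> {1..6}" and jl: "j \<in> {1..3}" "l \<in> {1..3}" for i j k l
    using gram_swap_unique[OF P witness_form_def ik jl]
    unfolding g_def h[OF ik(1) jl(1)] h[OF ik(1) jl(2)] .
  \<comment> \<open>For \<open>k = i\<close> the two terms on each side of \<open>polar\<close>
    coincide.\<close>
  have same_row: "g i j i l = h i j i l" if "i \<in> {1..6}" "j \<in> {1..3}" "l \<in> {1..3}" for i j l
  proof -
    have "g i l i j = g i j i l" "h i l i j = h i j i l"
      unfolding g_def h_def by (auto simp: mult.commute)
    then show ?thesis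
      using polar[OF that(1,1,2,3)] by simp
  qed

  \<comment> \<open>The squared norm of this combination involves only inner products within row
    \<open>i\<close>, which are known, and evaluates to 0.\<close>
  have relation: "(\<Sum>j=1..3. row_relation i j * b p i j) = 0" if i: "i \<in> {1..6}" and p: "p \<in> {1..r}" for i p
  proof -
    have "(\<Sum>p=1..r. (\<Sum>j=1..3. row_relation i j * b p i j)\<^sup>2) =
        (\<Sum>p=1..r. \<Sum>j=1..3. \<Sum>l=1..3. row_relation i j * row_relation i l * (b p i j * b p i l))"
      unfolding power2_eq_square sum_product by (simp add: mult_ac)
    also have "\<dots> = (\<Sum>j=1..3. \<Sum>l=1..3. \<Sum>p=1..r. row_relation i j * row_relation i l * (b p i j * b p i l))"
      by (subst sum.swap, rule sum.cong[OF refl])+ (rule refl)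
    also have "\<dots> = (\<Sum>j=1..3. \<Sum>l=1..3. row_relation i j * row_relation i l * h i j i l)"
      using same_row[OF i] unfolding g_def by (simp add: sum_distrib_left[symmetric])
    also have "\<dots> = 0"
      using i unfolding sum_upto_3 h_def by (elim row_cases) (simp_all add: row_relation_def label_def)
    finally show ?thesis
      using p by (subst (asm) sum_nonneg_eq_0_iff) auto
  qed
  have kernel_left: "(\<Sum>j=1..3. row_relation i j * g i j k l) = 0" if "i \<in> {1..6}" for i k l
  proof -
    have "(\<Sum>j=1..3. row_relation i j * g i j k l) = (\<Sum>p=1..r. (\<Sum>j=1..3. row_relation i j * b p i j) * b p k l)"
      unfolding g_def sum_distrib_left sum_distrib_right by (subst sum.swap) (simp add: mult.assoc)
    then show ?thesis
      using relation[OF that] by simp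
  qed
  have "g i j k l = h i j k l"
  proof (cases "i = k")
    case True
    then show ?thesis
      using same_row i j l by simp
  next
    case False
    have g_sym: "g i j k l = g k l i j" for i j k l
      unfolding g_def by (simp add: mult.commute)
    have h0: "h i j k l = 0" if "j \<in> {1..3}" "l \<in> {1..3}" for j l
      using label_row[OF i that(1) k that(2)] False unfolding h_def by auto
    have skew: "g i j k l = - g i l k j" if "j \<in> {1..3}" "l \<in> {1..3}" for j l
      using polar[OF i k that] h0[OF that] h0[OF that(2,1)] by simp
    have "g i j k j = 0" if "j \<in> {1..3}" for j
      using skew[OF that that] by linarith
    then have diag: "g i 1 k 1 = 0" "g i 2 k 2 = 0" "g i 3 k 3 = 0"
      by simp_all
    have lower: "g i 2 k 1 = - g i 1 k 2" "g i 3 k 1 = - g i 1 k 3" "g i 3 k 2 = - g i 2 k 3"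
      by (rule skew; simp)+
    have left: "row_relation i 2 * g i 1 k 2 + row_relation i 3 * g i 1 k 3 = 0"
      "row_relation i 1 * g i 1 k 2 = row_relation i 3 * g i 2 k 3"
      "row_relation i 1 * g i 1 k 3 + row_relation i 2 * g i 2 k 3 = 0"
      using kernel_left[OF i, of k 1] kernel_left[OF i, of k 2] kernel_left[OF i, of k 3]
      unfolding sum_upto_3 diag lower by linarith+
    \<comment> \<open>By symmetry of \<open>g\<close>, the relation of row \<open>k\<close> gives a
      second kernel vector of the same skew matrix.\<close>
    have right: "row_relation k 2 * g i 1 k 2 + row_relation k 3 * g i 1 k 3 = 0"
      "row_relation k 1 * g i 1 k 2 = row_relation k 3 * g i 2 k 3"
      "row_relation k 1 * g i 1 k 3 + row_relation k 2 * g i 2 k 3 = 0"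
      using kernel_left[OF k, of i 1] kernel_left[OF k, of i 2] kernel_left[OF k, of i 3]
      unfolding sum_upto_3 g_sym[of k _ i] diag lower by linarith+
    note zero = skew_eq_0[OF left right row_relation_independent[OF i k False]]
    have "g i j k l = 0"
      using j l diag lower zero by (elim column_cases) simp_all
    then show ?thesis
      using h0[OF j l] by simp
  qed
  then show ?thesis
    unfolding g_def h_def .
qed

lemma witness_form_rank:
  assumes "sum_of_squares 6 3 r witness_form"
  shows "12 \<le> r"
proof -
  obtain b where P: "witness_form = (\<lambda>x y. \<Sum>p=1..r. (\<Sum>i=1..6. \<Sum>j=1..3. b p i j * x i * y j)\<^sup>2)"
    using assms unfolding sum_of_squares_iff by blast
  \<comment> \<open>One cell from each of the twelve edges, so the labels on \<open>T\<close> are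
    nonzero and distinct.\<close>
  define T :: "cell set" where
    "T = {(1,1), (1,2), (2,1), (2,3), (3,2), (3,3), (4,1), (4,2), (5,2), (5,1), (6,3), (6,1)}"
  have T_cells: "fst c \<in> {1..6}" "snd c \<in> {1..3}" if "c \<in> T" for c
    using that unfolding T_def by auto
  have label_T: "label (fst c) (snd c) \<noteq> 0" if "c \<in> T" for c
    using that unfolding T_def by (auto simp: label_def)
  have "inj_on (\<lambda>c. label (fst c) (snd c)) T"
    unfolding T_def by (simp add: label_def)
  then have "(\<Sum>p=1..r. b p (fst c) (snd c) * b p (fst d) (snd d)) = of_bool (c = d)"
    if "c \<in> T" "d \<in> T" for c d
    using that label_T unfolding witness_form_gram[OF P T_cells(1)[OF that(1)] T_cells(1)[OF that(2)]
      T_cells(2)[OF that(1)] T_cells(2)[OF that(2)]]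
    by (auto dest: inj_onD)
  then have "card T \<le> card {1..r}"
    by (intro orthonormal_card_le[where v = "\<lambda>c p. b p (fst c) (snd c)"]) (auto simp: T_def)
  then show ?thesis
    unfolding T_def by simp
qed

theorem theorem14:
  shows "(\<exists>E1 E2. aug_bipartite 6 3 E1 E2 \<and> limited 6 3 E1 \<and>
            card E1 + card E2 = 12 \<and> weak_admissible E1 E2) \<and>
         z_wL 6 3 \<ge> 12 \<and> 12 > z_L 6 3 \<and> z_L 6 3 = 11 \<and>
         BSR 6 3 \<ge> 12"
proof -
  have ex: "\<exists>E1 E2. aug_bipartite 6 3 E1 E2 \<and> limited 6 3 E1 \<and>
      card E1 + card E2 = 12 \<and> weak_admissible E1 E2"
    using witness_aug_bipartite(1) witness_weak_admissible card_witness
    by (intro exI[of _ witness_E1] exI[of _ witness_E2]) (simp add: limited_6_3_iff)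
  then have "12 \<in> {card E1 + card E2 | E1 E2.
      aug_bipartite 6 3 E1 E2 \<and> limited 6 3 E1 \<and> weak_admissible E1 E2}"
    by force
  then have "12 \<le> z_wL 6 3"
    unfolding z_wL_def by (intro Max_ge finite_aug_bipartite)
  moreover have "SOS 6 3 witness_form"
    unfolding SOS_def sum_of_squares_iff by (intro exI) (rule witness_form_def)
  then have "12 \<le> BSR 6 3"
    using witness_form_rank[OF sum_of_squares_SOS_rank] SOS_rank_le_BSR order_trans by blast
  ultimately show ?thesis
    using ex z_L_6_3 by simp
qed

end
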